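(* Let $h:\mathbb{R}^n\to\overline{\mathbb{R}}$ be a proper, lower semicontinuous and $\kappa$-quasar-convex function ($\kappa\in(0,1]$) with respect to every element of $\arg\min_{\mathbb{R}^n}h$. Suppose that $0<\beta'\le\beta_k\le\beta''$ for all $k\in\mathbb{N}_0$. Let $\{x^k\}_{k\in\mathbb{N}_0}$ be generated by HiPPA with parameter $p>1$, and assume that $x^k\to\overline{x}\in\arg\min_{\mathbb{R}^n}h$. For $\varepsilon>0$, let $\mathcal{N}(\varepsilon)$ denote the number of iterations required to obtain an iterate $x^k$ satisfying $h(x^k)-h(\overline{x})\le\varepsilon$. Then the following assertions hold: (a) If $p\in(1,2)$, then $$\mathcal{N}(\varepsilon)\le\left\lceil 1+\left(\frac{\|x^0-\overline{x}\|^p}{2^{p-1}\beta'\kappa}\right)^{\frac{1}{p-1}}\frac{1}{\varepsilon^{\frac{1}{p-1}}}\right\rceil.$$ In particular, $\mathcal{N}(\varepsilon)=\mathcal{O}\big(\varepsilon^{-\frac{1}{p-1}}\big)$. (b) If $p=2$, then $$\mathcal{N}(\varepsilon)\le\left\lceil 1+\frac{\|x^0-\overline{x}\|^2}{2\kappa\beta'\varepsilon}\right\rceil.$$ In particular, $\mathcal{N}(\varepsilon)=\mathcal{O}(\varepsilon^{-1})$. (c) If $p>2$, then $$\mathcal{N}(\varepsilon)\le\left\lceil 1+\left(\frac{1}{\beta'\kappa p}\right)^{\frac{2}{p}}\left(\frac{p-2}{p}\right)^{\frac{p-2}{p}}\frac{\|x^0-\overline{x}\|^2}{\varepsilon^{\frac{2}{p}}}\right\rceil.$$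 In particular, $\mathcal{N}(\varepsilon)=\mathcal{O}(\varepsilon^{-\frac{2}{p}})$.
   Context: $\overline{\mathbb{R}}=\mathbb{R}\cup\{+\infty\}$; $\mathrm{dom}(h)=\{x:h(x)<+\infty\}$; $h$ is proper if $\mathrm{dom}(h)\neq\emptyset$; $\|\cdot\|$ is the Euclidean norm; $\mathbb{N}_0=\mathbb{N}\cup\{0\}$. Let $\kappa\in(0,1]$. A proper function $h:\mathbb{R}^n\to\overline{\mathbb{R}}$ with convex domain and $\arg\min_{\mathbb{R}^n}h\neq\emptyset$ is called $\kappa$-quasar-convex with respect to $\overline{x}\in\arg\min_{\mathbb{R}^n}h$ if for all $x\in\mathrm{dom}(h)$ and all $\lambda\in[0,1]$, $$h(\lambda\overline{x}+(1-\lambda)x)\le\kappa\lambda h(\overline{x})+(1-\kappa\lambda)h(x).$$ For $p>1$, $\beta>0$: $\mathrm{Prox}^p_{\beta h}(x):=\arg\min_{y\in\mathbb{R}^n}\{h(y)+\frac{1}{p\beta}\|x-y\|^p\}$ (set-valued). HiPPA (high-order proximal-point algorithm): given $x^0\in\mathbb{R}^n$, $p>1$ and parameters $\{\beta_k\}_{k\in\mathbb{N}_0}\subseteq(0,+\infty)$, at iteration $k=0,1,2,\dots$ choose $x^{k+1}\in\mathrm{Prox}^p_{\beta_kh}(x^k)$; if $x^{k+1}=x^k$ stop, otherwise continue with $k+1$ (so an infinite generated sequence has $x^{k+1}\ne x^k$ for all $k$). *)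

theory Defs
  imports "HOL-Analysis.Analysis" "HOL-Library.Landau_Symbols"
begin

definition edom :: "('a \<Rightarrow> ereal) \<Rightarrow> 'a set" where
  "edom h = {x. h x < \<infinity>}"

(* Functions with values in the reals extended by +\<infinity> only are rendered as
   ereal-valued functions that never take the value -\<infinity>; this is part of properness here. *)
definition proper :: "('a \<Rightarrow> ereal) \<Rightarrow> bool" where
  "proper h \<longleftrightarrow> (\<forall>x. h x \<noteq> -\<infinity>) \<and> edom h \<noteq> {}"

definition lower_semicontinuous :: "('a::topological_space \<Rightarrow> ereal) \<Rightarrow> bool" where
  "lower_semicontinuous h \<longleftrightarrow> (\<forall>x. h x \<le> Liminf (at x) h)"

definition argmin_set :: "('a \<Rightarrow> ereal) \<Rightarrow> 'a set" where
  "argmin_set h = {x. is_arg_min h (\<lambda>_. True) x}"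

(* Both function values on the right-hand side are finite, since z is a minimizer of a proper
   function and x lies in its domain. *)
definition quasar_convex :: "real \<Rightarrow> ('a::real_vector \<Rightarrow> ereal) \<Rightarrow> 'a \<Rightarrow> bool" where
  "quasar_convex \<kappa> h z \<longleftrightarrow>
     0 < \<kappa> \<and> \<kappa> \<le> 1 \<and> proper h \<and> convex (edom h) \<and> z \<in> argmin_set h \<and>
     (\<forall>x\<in>edom h. \<forall>t\<in>{0..1}.
        h (t *\<^sub>R z + (1 - t) *\<^sub>R x) \<le> ereal (\<kappa> * t) * h z + ereal (1 - \<kappa> * t) * h x)"

definition prox :: "real \<Rightarrow> real \<Rightarrow> ('a::real_normed_vector \<Rightarrow> ereal) \<Rightarrow> 'a \<Rightarrow> 'a set" where
  "prox p \<beta> h x = argmin_set (\<lambda>y. h y + ereal (1 / (p * \<beta>) * norm (x - y) powr p))"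

(* The algorithm stops as soon as two consecutive iterates coincide, so in an infinite
   generated sequence they always differ. *)
definition hippa_sequence ::
  "real \<Rightarrow> (nat \<Rightarrow> real) \<Rightarrow> ('a::real_normed_vector \<Rightarrow> ereal) \<Rightarrow> (nat \<Rightarrow> 'a) \<Rightarrow> bool" where
  "hippa_sequence p \<beta> h x \<longleftrightarrow>
     1 < p \<and> (\<forall>k. 0 < \<beta> k) \<and> (\<forall>k. x (Suc k) \<in> prox p (\<beta> k) h (x k) \<and> x (Suc k) \<noteq> x k)"

(* Least index of an iterate of the required accuracy, and \<infinity> if there is none. *)
definition iterations_needed :: "('a \<Rightarrow> ereal) \<Rightarrow> (nat \<Rightarrow> 'a) \<Rightarrow> 'a \<Rightarrow> real \<Rightarrow> enat" where
  "iterations_needed h x z \<epsilon> = (INF k\<in>{k. h (x k) - h z \<le> ereal \<epsilon>}. enat k)"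

end

theory Submission
  imports Defs
begin

text \<open>
  Fix a minimizer \<open>z\<close> of \<open>h\<close> and write \<open>a\<^sub>k = \<parallel>x\<^sub>k - z\<parallel>\<close>, \<open>d\<^sub>k = \<parallel>x\<^sub>k - x\<^sub>k\<^sub>+\<^sub>1\<parallel>\<close> and
  \<open>s\<^sub>k = \<langle>x\<^sub>k - x\<^sub>k\<^sub>+\<^sub>1, x\<^sub>k\<^sub>+\<^sub>1 - z\<rangle>\<close>. Comparing the proximal objective at \<open>x\<^sub>k\<^sub>+\<^sub>1\<close> with its values
  on the segment from \<open>x\<^sub>k\<^sub>+\<^sub>1\<close> to \<open>z\<close>, bounding \<open>h\<close> there by quasar-convexity, and
  differentiating at \<open>x\<^sub>k\<^sub>+\<^sub>1\<close> gives (lemma \<open>prox_gap_le\<close>)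
  \<open>\<kappa> \<beta>\<^sub>k (h x\<^sub>k\<^sub>+\<^sub>1 - h z) \<le> d\<^sub>k powr (p - 2) * s\<^sub>k\<close>, while
  \<open>2 s\<^sub>k = a\<^sub>k\<^sup>2 - a\<^sub>k\<^sub>+\<^sub>1\<^sup>2 - d\<^sub>k\<^sup>2\<close>. In particular \<open>a\<^sub>k\<close> is nonincreasing.

  As long as the gap \<open>h x\<^sub>k\<^sub>+\<^sub>1 - h z\<close> exceeds \<open>\<epsilon>\<close>, this forces \<open>a\<^sub>k\<^sup>2\<close> to drop by a fixed amount
  \<open>1 / K\<close> in each step. For \<open>p = 2\<close> this is immediate. For \<open>p < 2\<close> the Cauchy-Schwarz bound
  \<open>s\<^sub>k \<le> d\<^sub>k a\<^sub>k\<^sub>+\<^sub>1 \<le> d\<^sub>k a\<^sub>0\<close> eliminates \<open>d\<^sub>k\<close>, whose exponent is negative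
  (\<open>step_decrease_small_p\<close>). For \<open>p > 2\<close> the maximum of \<open>d powr (p - 2) * (\<Delta> - d\<^sup>2)\<close> over \<open>d\<close>
  is estimated by the weighted arithmetic-geometric mean inequality (\<open>step_decrease_large_p\<close>).
  Summing the drops, at most \<open>K a\<^sub>0\<^sup>2\<close> of the iterates \<open>x\<^sub>1, x\<^sub>2, \<dots>\<close> precede the first accurate
  one (\<open>iterations_needed_le\<close>), whose index is therefore at most \<open>\<lceil>1 + K a\<^sub>0\<^sup>2\<rceil>\<close>; the value of \<open>K\<close>
  makes this the stated bound in each case.
\<close>

section \<open>Minimizers and proximal points\<close>

lemma argmin_setD: "z \<in> argmin_set f \<Longrightarrow> f z \<le> f y"
  by (auto simp: argmin_set_def is_arg_min_def not_less)

lemma argmin_set_finite: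
  assumes "proper h" "z \<in> argmin_set h"
  obtains c where "h z = ereal c"
proof -
  obtain y where "h y < \<infinity>" using assms(1) by (auto simp: proper_def edom_def)
  with argmin_setD[OF assms(2), of y] have "h z < \<infinity>" by (rule le_less_trans)
  moreover have "h z \<noteq> -\<infinity>" using assms(1) by (auto simp: proper_def)
  ultimately show ?thesis using that by (cases "h z") auto
qed

lemma prox_finite:
  assumes "proper h" "y \<in> prox p \<beta> h x"
  obtains c where "h y = ereal c"
proof -
  obtain z where z: "h z < \<infinity>" using assms(1) by (auto simp: proper_def edom_def)
  have "h y + ereal (1 / (p * \<beta>) * norm (x - y) powr p)
      \<le> h z + ereal (1 / (p * \<beta>) * norm (x - z) powr p)"
    using argmin_setD[OF assms(2)[unfolded prox_def]] .
  also have "\<dots> < \<infinity>" using z by (cases "h z") auto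
  finally have "h y < \<infinity>" by (cases "h y") auto
  moreover have "h y \<noteq> -\<infinity>" using assms(1) by (auto simp: proper_def)
  ultimately show ?thesis using that by (cases "h y") auto
qed

section \<open>The optimality condition of a proximal step\<close>

lemma norm_powr_line_derivative:
  fixes v w :: "'a::real_inner"
  assumes "v \<noteq> 0"
  shows "((\<lambda>t. norm (v + t *\<^sub>R w) powr p) has_real_derivative
            p * (norm v powr (p - 2) * (v \<bullet> w))) (at 0)"
proof -
  define q where "q = (\<lambda>t. v \<bullet> v + t * (2 * (v \<bullet> w)) + t\<^sup>2 * (w \<bullet> w))"
  have nq: "norm (v + t *\<^sub>R w) powr p = q t powr (p / 2)" for t
  proof -
    have "(norm (v + t *\<^sub>R w))\<^sup>2 = q t"
      unfolding q_def power2_norm_eq_inner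
      by (simp add: inner_add_left inner_add_right inner_commute power2_eq_square algebra_simps)
    then have "q t powr (p / 2) = (norm (v + t *\<^sub>R w) powr 2) powr (p / 2)"
      by simp
    also have "\<dots> = norm (v + t *\<^sub>R w) powr p" by (simp only: powr_powr) simp
    finally show ?thesis by simp
  qed
  have q0: "q 0 = (norm v)\<^sup>2" by (simp add: q_def power2_norm_eq_inner)
  have dq: "(q has_real_derivative 2 * (v \<bullet> w)) (at 0)"
    unfolding q_def by (auto intro!: derivative_eq_intros)
  have "((\<lambda>t. q t powr (p / 2)) has_real_derivative
      (p / 2) * q 0 powr (p / 2 - 1) * (2 * (v \<bullet> w))) (at 0)"
    using DERIV_fun_powr[OF dq, of "p / 2"] assms by (simp add: q0)
  moreover have "q 0 powr (p / 2 - 1) = norm v powr (p - 2)"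
  proof -
    have "q 0 powr (p / 2 - 1) = (norm v powr 2) powr (p / 2 - 1)" using q0 by simp
    also have "\<dots> = norm v powr (p - 2)" by (simp only: powr_powr) (simp add: algebra_simps)
    finally show ?thesis .
  qed
  ultimately show ?thesis by (simp add: nq)
qed

text \<open>The one-step estimate: the first-order optimality condition of the proximal subproblem
  in the direction of the minimizer, which needs no differentiability of \<open>h\<close>.\<close>

lemma prox_gap_le:
  fixes h :: "'a::real_inner \<Rightarrow> ereal"
  assumes qc: "quasar_convex \<kappa> h z"
    and p: "0 < p" and b: "0 < \<beta>"
    and prox: "y \<in> prox p \<beta> h x" and ne: "y \<noteq> x"
    and hy: "h y = ereal f" and hz: "h z = ereal c"
  shows "\<kappa> * \<beta> * (f - c) \<le> norm (x - y) powr (p - 2) * ((x - y) \<bullet> (y - z))"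
proof -
  define g where "g = (\<lambda>t. norm ((x - y) + t *\<^sub>R (y - z)) powr p)"
  define D where "D = norm (x - y) powr (p - 2) * ((x - y) \<bullet> (y - z))"
  have yd: "y \<in> edom h" by (simp add: edom_def hy)
  have le: "p * \<beta> * \<kappa> * (f - c) \<le> (g t - g 0) / t" if t: "0 < t" "t < 1" for t
  proof -
    define w where "w = t *\<^sub>R z + (1 - t) *\<^sub>R y"
    have "x - w = (x - y) + t *\<^sub>R (y - z)" by (simp add: w_def algebra_simps)
    then have gw: "norm (x - w) powr p = g t" by (simp only: g_def)
    have g0: "norm (x - y) powr p = g 0" by (simp add: g_def)
    have hw: "h w \<le> ereal (\<kappa> * t * c + (1 - \<kappa> * t) * f)"
      using qc yd t by (auto simp: quasar_convex_def hy hz w_def)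
    have "ereal (f + 1 / (p * \<beta>) * g 0) \<le> h w + ereal (1 / (p * \<beta>) * g t)"
      using argmin_setD[OF prox[unfolded prox_def], of w] by (simp add: hy gw g0)
    also have "\<dots> \<le> ereal (\<kappa> * t * c + (1 - \<kappa> * t) * f) + ereal (1 / (p * \<beta>) * g t)"
      by (intro add_right_mono hw)
    finally have "f + 1 / (p * \<beta>) * g 0 \<le> \<kappa> * t * c + (1 - \<kappa> * t) * f + 1 / (p * \<beta>) * g t"
      by simp
    then have "\<kappa> * t * (f - c) \<le> (g t - g 0) / (p * \<beta>)"
      by (simp add: algebra_simps diff_divide_distrib)
    then have "\<kappa> * t * (f - c) * (p * \<beta>) \<le> g t - g 0" using p b by (simp add: pos_le_divide_eq)
    then show ?thesis using t by (simp add: pos_le_divide_eq mult_ac)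
  qed
  have "(g has_real_derivative p * D) (at 0)"
    unfolding g_def D_def by (rule norm_powr_line_derivative) (use ne in auto)
  then have "((\<lambda>t. (g t - g 0) / t) \<longlongrightarrow> p * D) (at 0)"
    by (simp add: has_field_derivative_iff)
  then have "((\<lambda>t. (g t - g 0) / t) \<longlongrightarrow> p * D) (at_right 0)"
    by (rule tendsto_mono[rotated]) (simp add: at_le)
  moreover have "\<forall>\<^sub>F t in at_right (0::real). p * \<beta> * \<kappa> * (f - c) \<le> (g t - g 0) / t"
    using eventually_at_right_real[of 0 1] by (auto elim!: eventually_mono intro!: le)
  ultimately have "p * \<beta> * \<kappa> * (f - c) \<le> p * D"
    by (intro tendsto_lowerbound[of _ _ "at_right 0"]) auto
  then have "p * (\<kappa> * \<beta> * (f - c)) \<le> p * D" by (simp add: mult_ac)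
  then show ?thesis using p by (simp add: D_def)
qed

lemma norm_square_three_point:
  fixes x y z :: "'a::real_inner"
  shows "2 * ((x - y) \<bullet> (y - z)) = (norm (x - z))\<^sup>2 - (norm (y - z))\<^sup>2 - (norm (x - y))\<^sup>2"
  by (simp add: power2_norm_eq_inner inner_diff_left inner_diff_right inner_commute)

section \<open>Decrease of the squared distance to the minimizer\<close>

text \<open>In the next two lemmas, \<open>g\<close> is the lower bound \<open>\<kappa> \<beta>' \<epsilon>\<close> for the scaled gap, \<open>d\<close> the
  step length, \<open>s\<close> the inner product \<open>s\<^sub>k\<close>, \<open>a\<close> and \<open>A\<close> the distances \<open>a\<^sub>k\<^sub>+\<^sub>1\<close> and \<open>a\<^sub>0\<close>, and
  \<open>\<Delta>\<close> the decrease \<open>a\<^sub>k\<^sup>2 - a\<^sub>k\<^sub>+\<^sub>1\<^sup>2\<close>.\<close>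

lemma step_decrease_small_p:
  fixes a A d s g p :: real
  assumes p: "1 < p" "p \<le> 2" and g: "0 < g" and d: "0 < d" and s: "s \<le> d * a"
    and a: "0 \<le> a" "a \<le> A" and gap: "g \<le> d powr (p - 2) * s"
  shows "1 \<le> A powr ((2 - p) / (p - 1)) / g powr (1 / (p - 1)) * s"
proof -
  have "0 < d powr (p - 2) * s" using g gap by linarith
  then have s0: "0 < s" using d by (simp add: zero_less_mult_iff)
  then have "0 < d * a" using s by linarith
  then have a0: "0 < a" using d by (simp add: zero_less_mult_iff)
  have "d powr (p - 2) \<le> (s / a) powr (p - 2)"
    by (rule powr_mono2') (use p s s0 a0 in \<open>auto simp: pos_divide_le_eq\<close>)
  then have "g \<le> (s / a) powr (p - 2) * s"
    using gap s0 by (meson less_imp_le mult_right_mono order_trans)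
  also have "\<dots> = s powr (p - 1) * a powr (2 - p)"
  proof -
    have "s powr (p - 1) = s powr (p - 2) * s"
      using s0 powr_add[of s "p - 2" 1] by simp
    moreover have "a powr (2 - p) = inverse (a powr (p - 2))"
      using powr_minus[of a "p - 2"] by simp
    ultimately show ?thesis using s0 a0 by (simp add: powr_divide field_simps)
  qed
  also have "\<dots> \<le> s powr (p - 1) * A powr (2 - p)"
    using a0 a p by (intro mult_left_mono powr_mono2) auto
  finally have "g powr (1 / (p - 1)) \<le> (s powr (p - 1) * A powr (2 - p)) powr (1 / (p - 1))"
    using g p by (intro powr_mono2) auto
  also have "\<dots> = s * A powr ((2 - p) / (p - 1))"
    using p s0 by (simp add: powr_mult powr_powr)
  finally show ?thesis using g by (simp add: field_simps)
qed

lemma step_decrease_large_p: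
  fixes \<Delta> d g p :: real
  assumes p: "2 < p" and g: "0 < g" and d: "0 < d"
    and gap: "2 * g \<le> d powr (p - 2) * (\<Delta> - d\<^sup>2)"
  shows "1 \<le> (1 / (p * g)) powr (2 / p) * ((p - 2) / p) powr ((p - 2) / p) * \<Delta>"
proof -
  define r where "r = (p - 2) / p"
  have r: "0 < r" "r < 1" "2 / p = 1 - r" using p by (auto simp: r_def field_simps)
  have "0 < d powr (p - 2) * (\<Delta> - d\<^sup>2)" using g gap by linarith
  then have D: "0 < \<Delta> - d\<^sup>2" using d by (simp add: zero_less_mult_iff)
  have "p * g \<le> d powr (p - 2) * (\<Delta> - d\<^sup>2) * (p / 2)"
    using gap p mult_right_mono[OF gap, of "p / 2"] by (simp add: mult_ac)
  then have "(p * g) powr (2 / p) \<le> (d powr (p - 2) * (\<Delta> - d\<^sup>2) * (p / 2)) powr (2 / p)"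
    using g p by (intro powr_mono2) auto
  also have "\<dots> = (d\<^sup>2) powr r * ((\<Delta> - d\<^sup>2) * (p / 2)) powr (1 - r)"
  proof -
    have "(d powr (p - 2)) powr (2 / p) = (d powr 2) powr r"
      unfolding powr_powr by (simp add: r_def algebra_simps)
    also have "d powr 2 = d\<^sup>2" using d by simp
    finally have "(d powr (p - 2)) powr (2 / p) = (d\<^sup>2) powr r" .
    moreover have "(d powr (p - 2) * ((\<Delta> - d\<^sup>2) * (p / 2))) powr (2 / p)
        = (d powr (p - 2)) powr (2 / p) * ((\<Delta> - d\<^sup>2) * (p / 2)) powr (2 / p)"
      by (rule powr_mult)
    ultimately show ?thesis unfolding mult.assoc by (simp only: r(3))
  qed
  finally have 1: "(p * g) powr (2 / p) \<le> (d\<^sup>2) powr r * ((\<Delta> - d\<^sup>2) * (p / 2)) powr (1 - r)" .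
  \<comment> \<open>The weights and arguments are chosen so that the arithmetic mean is exactly \<open>\<Delta>\<close>.\<close>
  have "(d\<^sup>2 / r) powr r * ((\<Delta> - d\<^sup>2) * (p / 2)) powr (1 - r)
      \<le> r * (d\<^sup>2 / r) + (1 - r) * ((\<Delta> - d\<^sup>2) * (p / 2))"
    using r D p d by (intro Youngs_inequality_0) auto
  also have "(1 - r) * ((\<Delta> - d\<^sup>2) * (p / 2)) = \<Delta> - d\<^sup>2" using p by (simp flip: r(3))
  also have "r * (d\<^sup>2 / r) + (\<Delta> - d\<^sup>2) = \<Delta>" using r by simp
  also have "(d\<^sup>2 / r) powr r = (d\<^sup>2) powr r / r powr r" using r by (simp add: powr_divide)
  finally have "(d\<^sup>2) powr r * ((\<Delta> - d\<^sup>2) * (p / 2)) powr (1 - r) \<le> r powr r * \<Delta>"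
    using r by (simp add: pos_divide_le_eq mult_ac)
  with 1 have "(p * g) powr (2 / p) \<le> r powr r * \<Delta>" by linarith
  then show ?thesis using g p by (simp add: powr_divide field_simps flip: r_def)
qed

section \<open>Counting iterations\<close>

text \<open>The starting point may lie outside the domain of \<open>h\<close>, so values are assumed finite only from
  index 1 on; this shift is the 1 added in the bound.\<close>

lemma iterations_needed_le:
  fixes u :: "nat \<Rightarrow> real"
  assumes fin: "\<And>k. h (x (Suc k)) = ereal (f k)" and hz: "h z = ereal c"
    and K: "0 \<le> K" and u: "\<And>k. 0 \<le> u k"
    and step: "\<And>k. \<epsilon> < f k - c \<Longrightarrow> 1 \<le> K * (u k - u (Suc k))"
  shows "iterations_needed h x z \<epsilon> \<le> enat (nat \<lceil>1 + K * u 0\<rceil>)"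
proof -
  define M where "M = nat \<lceil>1 + K * u 0\<rceil>"
  have M: "1 + K * u 0 \<le> real M" unfolding M_def by linarith
  have "\<exists>k<M. f k - c \<le> \<epsilon>"
  proof (rule ccontr)
    assume "\<not> ?thesis"
    then have *: "1 \<le> K * (u k - u (Suc k))" if "k < M" for k
      using step that by (meson not_less)
    have "real M = (\<Sum>k<M. 1)" by simp
    also have "\<dots> \<le> (\<Sum>k<M. K * (u k - u (Suc k)))" using * by (intro sum_mono) auto
    also have "\<dots> = K * (u 0 - u M)" by (simp add: sum_lessThan_telescope' flip: sum_distrib_left)
    also have "\<dots> \<le> K * u 0" using K u[of M] by (intro mult_left_mono) auto
    finally show False using M by linarith
  qed
  then obtain k where k: "k < M" "f k - c \<le> \<epsilon>" by blast
  have "iterations_needed h x z \<epsilon> \<le> enat (Suc k)"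
    unfolding iterations_needed_def by (rule INF_lower) (use k in \<open>simp add: fin hz\<close>)
  also have "\<dots> \<le> enat M" using k by simp
  finally show ?thesis by (simp add: M_def)
qed

text \<open>The bound makes \<open>N \<epsilon>\<close> finite, so the default value of \<open>the_enat\<close> at \<open>\<infinity>\<close> plays no role.\<close>

lemma enat_ceiling_bound_bigo:
  fixes N :: "real \<Rightarrow> enat"
  assumes C: "0 \<le> C" and r: "0 \<le> r"
    and N: "\<And>\<epsilon>. 0 < \<epsilon> \<Longrightarrow> N \<epsilon> \<le> enat (nat \<lceil>1 + C * \<epsilon> powr (- r)\<rceil>)"
  shows "(\<lambda>\<epsilon>. real (the_enat (N \<epsilon>))) \<in> O[at_right 0](\<lambda>\<epsilon>. \<epsilon> powr (- r))"
proof (rule bigoI[where c = "C + 2"])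
  have "real (the_enat (N \<epsilon>)) \<le> (C + 2) * \<epsilon> powr (- r)" if \<epsilon>: "0 < \<epsilon>" "\<epsilon> < 1" for \<epsilon>
  proof -
    obtain n where n: "N \<epsilon> = enat n" using N[OF \<epsilon>(1)] by (cases "N \<epsilon>") auto
    have "n \<le> nat \<lceil>1 + C * \<epsilon> powr (- r)\<rceil>" using N[OF \<epsilon>(1)] by (simp add: n)
    moreover have "0 \<le> C * \<epsilon> powr (- r)" using C by simp
    ultimately have "real n \<le> 2 + C * \<epsilon> powr (- r)" by linarith
    moreover have "1 \<le> \<epsilon> powr (- r)"
      using powr_mono2'[of "- r" \<epsilon> 1] r \<epsilon> by simp
    ultimately show ?thesis by (simp add: n algebra_simps)
  qed
  then show "\<forall>\<^sub>F \<epsilon> in at_right 0.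
      norm (real (the_enat (N \<epsilon>))) \<le> (C + 2) * norm (\<epsilon> powr (- r))"
    using eventually_at_right_real[of 0 1] by (auto elim!: eventually_mono)
qed

section \<open>Complexity of the high-order proximal-point algorithm\<close>

theorem theorem53:
  fixes h :: "real ^ 'n \<Rightarrow> ereal"
    and x :: "nat \<Rightarrow> real ^ 'n" and xbar :: "real ^ 'n"
    and \<kappa> p \<beta>' \<beta>'' :: real and \<beta> :: "nat \<Rightarrow> real"
    and N :: "real \<Rightarrow> enat"
  assumes kappa: "0 < \<kappa>" "\<kappa> \<le> 1"
    and proper: "proper h"
    and lsc: "lower_semicontinuous h"
    and quasar: "\<forall>z\<in>argmin_set h. quasar_convex \<kappa> h z"
    and beta: "0 < \<beta>'" "\<forall>k. \<beta>' \<le> \<beta> k \<and> \<beta> k \<le> \<beta>''"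
    and p: "1 < p"
    and hippa: "hippa_sequence p \<beta> h x"
    and lim: "x \<longlonglongrightarrow> xbar"
    and xbar: "xbar \<in> argmin_set h"
    and N: "\<forall>\<epsilon>>0. N \<epsilon> = iterations_needed h x xbar \<epsilon>"
  shows
    "(p < 2 \<longrightarrow>
        (\<forall>\<epsilon>>0. N \<epsilon> \<le> enat (nat \<lceil>1 +
            (norm (x 0 - xbar) powr p / (2 powr (p - 1) * \<beta>' * \<kappa>)) powr (1 / (p - 1))
              * (1 / \<epsilon> powr (1 / (p - 1)))\<rceil>)) \<and>
        (\<lambda>\<epsilon>. real (the_enat (N \<epsilon>))) \<in> O[at_right 0](\<lambda>\<epsilon>. \<epsilon> powr (- (1 / (p - 1))))) \<and>
     (p = 2 \<longrightarrow>
        (\<forall>\<epsilon>>0. N \<epsilon> \<le> enat (nat \<lceil>1 + (norm (x 0 - xbar))\<^sup>2 / (2 * \<kappa> * \<beta>' * \<epsilon>)\<rceil>)) \<and>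
        (\<lambda>\<epsilon>. real (the_enat (N \<epsilon>))) \<in> O[at_right 0](\<lambda>\<epsilon>. \<epsilon> powr (- 1))) \<and>
     (2 < p \<longrightarrow>
        (\<forall>\<epsilon>>0. N \<epsilon> \<le> enat (nat \<lceil>1 +
            (1 / (\<beta>' * \<kappa> * p)) powr (2 / p) * ((p - 2) / p) powr ((p - 2) / p)
              * ((norm (x 0 - xbar))\<^sup>2 / \<epsilon> powr (2 / p))\<rceil>)) \<and>
        (\<lambda>\<epsilon>. real (the_enat (N \<epsilon>))) \<in> O[at_right 0](\<lambda>\<epsilon>. \<epsilon> powr (- (2 / p))))"
proof -
  define a where "a = (\<lambda>k. norm (x k - xbar))"
  define d where "d = (\<lambda>k. norm (x k - x (Suc k)))"
  define s where "s = (\<lambda>k. (x k - x (Suc k)) \<bullet> (x (Suc k) - xbar))"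
  have qc: "quasar_convex \<kappa> h xbar" using quasar xbar by blast
  have xprox: "x (Suc k) \<in> prox p (\<beta> k) h (x k)" and xne: "x (Suc k) \<noteq> x k"
    and \<beta>0: "0 < \<beta> k" for k
    using hippa by (auto simp: hippa_sequence_def)
  obtain c where c: "h xbar = ereal c" using argmin_set_finite[OF proper xbar] .
  have "\<forall>k. \<exists>f. h (x (Suc k)) = ereal f" using prox_finite[OF proper xprox] by metis
  then obtain f where f: "\<And>k. h (x (Suc k)) = ereal (f k)" by metis
  have gap0: "0 \<le> f k - c" for k
    using argmin_setD[OF xbar, of "x (Suc k)"] by (simp add: f c)
  have d0: "0 < d k" for k using xne[of k] by (simp add: d_def)
  have a0: "0 \<le> a k" for k by (simp add: a_def)
  have main: "\<kappa> * \<beta>' * (f k - c) \<le> d k powr (p - 2) * s k" for k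
  proof -
    have "\<kappa> * \<beta>' * (f k - c) \<le> \<kappa> * \<beta> k * (f k - c)"
      using gap0[of k] kappa beta by (intro mult_right_mono mult_left_mono) auto
    also have "\<dots> \<le> d k powr (p - 2) * s k"
      unfolding d_def s_def
      by (rule prox_gap_le[OF qc _ \<beta>0 xprox xne f c]) (use p in simp)
    finally show ?thesis .
  qed
  have s2: "2 * s k = (a k)\<^sup>2 - (a (Suc k))\<^sup>2 - (d k)\<^sup>2" for k
    unfolding s_def a_def d_def by (rule norm_square_three_point)
  have "0 \<le> \<kappa> * \<beta>' * (f k - c)" for k using gap0[of k] kappa beta by simp
  then have "0 \<le> d k powr (p - 2) * s k" for k using main[of k] by (rule order_trans)
  then have s0: "0 \<le> s k" for k
    using d0[of k] zero_le_mult_iff[of "d k powr (p - 2)" "s k"] by (metis less_irrefl not_less powr_gt_zero)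
  have "(a (Suc k))\<^sup>2 \<le> (a k)\<^sup>2" for k
    using s2[of k] s0[of k] zero_le_power2[of "d k"] by linarith
  then have "decseq a" using a0 by (intro decseq_SucI) (auto intro: power2_le_imp_le)
  then have aA: "a k \<le> a 0" for k by (simp add: decseqD)
  have sda: "s k \<le> d k * a (Suc k)" for k
    unfolding s_def d_def a_def by (rule norm_cauchy_schwarz)
  have gap: "\<kappa> * \<beta>' * \<epsilon> \<le> d k powr (p - 2) * s k" if "\<epsilon> < f k - c" for k \<epsilon>
  proof -
    have "\<kappa> * \<beta>' * \<epsilon> \<le> \<kappa> * \<beta>' * (f k - c)" using that kappa beta by (intro mult_left_mono) auto
    with main[of k] show ?thesis by linarith
  qed
  have s_le: "2 * s k \<le> (a k)\<^sup>2 - (a (Suc k))\<^sup>2" for k using s2[of k] by simp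
  have bound: "N \<epsilon> \<le> enat (nat \<lceil>1 + K * (a 0)\<^sup>2\<rceil>)"
    if "0 < \<epsilon>" "0 \<le> K"
      "\<And>k. \<epsilon> < f k - c \<Longrightarrow> 1 \<le> K * ((a k)\<^sup>2 - (a (Suc k))\<^sup>2)" for \<epsilon> K
  proof -
    have "N \<epsilon> = iterations_needed h x xbar \<epsilon>" using N that(1) by blast
    then show ?thesis
      using iterations_needed_le[where h = h and x = x and f = f and z = xbar and c = c
          and K = K and \<epsilon> = \<epsilon> and u = "\<lambda>k. (a k)\<^sup>2"] f c that by simp
  qed
  have small: "N \<epsilon> \<le> enat (nat \<lceil>1 +
      (a 0 powr p / (2 powr (p - 1) * \<beta>' * \<kappa>)) powr (1 / (p - 1)) * (1 / \<epsilon> powr (1 / (p - 1)))\<rceil>)"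
    if p2: "p < 2" and \<epsilon>: "0 < \<epsilon>" for \<epsilon>
  proof -
    define g where "g = \<kappa> * \<beta>' * \<epsilon>"
    have g: "0 < g" using kappa beta \<epsilon> by (simp add: g_def)
    define L where "L = a 0 powr ((2 - p) / (p - 1)) / g powr (1 / (p - 1))"
    have L: "0 \<le> L" by (simp add: L_def)
    have "1 \<le> L / 2 * ((a k)\<^sup>2 - (a (Suc k))\<^sup>2)" if "\<epsilon> < f k - c" for k
    proof -
      have "1 \<le> L * s k" unfolding L_def
        by (rule step_decrease_small_p[where d = "d k" and a = "a (Suc k)"])
          (use p p2 g d0 sda a0 aA gap[OF that] in \<open>auto simp: g_def\<close>)
      also have "\<dots> \<le> L * (((a k)\<^sup>2 - (a (Suc k))\<^sup>2) / 2)"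
        using s_le[of k] L by (intro mult_left_mono) auto
      finally show ?thesis by simp
    qed
    then have "N \<epsilon> \<le> enat (nat \<lceil>1 + L / 2 * (a 0)\<^sup>2\<rceil>)" using \<epsilon> L by (intro bound) auto
    moreover have "L / 2 * (a 0)\<^sup>2 =
        (a 0 powr p / (2 powr (p - 1) * \<beta>' * \<kappa>)) powr (1 / (p - 1)) * (1 / \<epsilon> powr (1 / (p - 1)))"
    proof -
      have "(2 - p) / (p - 1) + 2 = p / (p - 1)" using p by (simp add: field_simps)
      then have "a 0 powr ((2 - p) / (p - 1)) * a 0 powr 2 = a 0 powr (p / (p - 1))"
        by (simp only: flip: powr_add)
      moreover have "a 0 powr 2 = (a 0)\<^sup>2" using a0 by simp
      ultimately have 1: "a 0 powr ((2 - p) / (p - 1)) * (a 0)\<^sup>2 = a 0 powr (p / (p - 1))" by simp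
      have "(2 powr (p - 1)) powr (1 / (p - 1)) = (2::real)" using p by (simp add: powr_powr)
      then show ?thesis using p kappa beta \<epsilon> a0
        by (simp add: L_def g_def powr_divide powr_mult powr_powr 1[symmetric] field_simps)
    qed
    ultimately show ?thesis by simp
  qed
  have quadratic: "N \<epsilon> \<le> enat (nat \<lceil>1 + (a 0)\<^sup>2 / (2 * \<kappa> * \<beta>' * \<epsilon>)\<rceil>)"
    if p2: "p = 2" and \<epsilon>: "0 < \<epsilon>" for \<epsilon>
  proof -
    have g: "0 < \<kappa> * \<beta>' * \<epsilon>" using kappa beta \<epsilon> by simp
    have "1 \<le> 1 / (2 * (\<kappa> * \<beta>' * \<epsilon>)) * ((a k)\<^sup>2 - (a (Suc k))\<^sup>2)" if "\<epsilon> < f k - c" for k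
    proof -
      have "\<kappa> * \<beta>' * \<epsilon> \<le> s k" using gap[OF that] d0[of k] p2 by simp
      with s_le[of k] g show ?thesis by (simp add: pos_le_divide_eq)
    qed
    from bound[OF \<epsilon> _ this] g show ?thesis by (simp add: mult_ac)
  qed
  have large: "N \<epsilon> \<le> enat (nat \<lceil>1 +
      (1 / (\<beta>' * \<kappa> * p)) powr (2 / p) * ((p - 2) / p) powr ((p - 2) / p)
        * ((a 0)\<^sup>2 / \<epsilon> powr (2 / p))\<rceil>)"
    if p2: "2 < p" and \<epsilon>: "0 < \<epsilon>" for \<epsilon>
  proof -
    define g where "g = \<kappa> * \<beta>' * \<epsilon>"
    have g: "0 < g" using kappa beta \<epsilon> by (simp add: g_def)
    define L where "L = (1 / (p * g)) powr (2 / p) * ((p - 2) / p) powr ((p - 2) / p)"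
    have "1 \<le> L * ((a k)\<^sup>2 - (a (Suc k))\<^sup>2)" if "\<epsilon> < f k - c" for k
      unfolding L_def
    proof (rule step_decrease_large_p[OF p2 g d0])
      have "2 * g \<le> d k powr (p - 2) * (2 * s k)" using gap[OF that] by (simp add: g_def)
      then show "2 * g \<le> d k powr (p - 2) * ((a k)\<^sup>2 - (a (Suc k))\<^sup>2 - (d k)\<^sup>2)"
        by (simp only: s2)
    qed
    then have "N \<epsilon> \<le> enat (nat \<lceil>1 + L * (a 0)\<^sup>2\<rceil>)" using \<epsilon> by (intro bound) (auto simp: L_def)
    moreover have "(1 / (p * g)) powr (2 / p) = (1 / (\<beta>' * \<kappa> * p)) powr (2 / p) / \<epsilon> powr (2 / p)"
      using p kappa beta \<epsilon> by (simp add: g_def powr_divide powr_mult mult_ac)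
    ultimately show ?thesis by (simp add: L_def mult_ac)
  qed
  have "(\<lambda>\<epsilon>. real (the_enat (N \<epsilon>))) \<in> O[at_right 0](\<lambda>\<epsilon>. \<epsilon> powr (- (1 / (p - 1))))" if "p < 2"
    using small[OF that] p
    by (intro enat_ceiling_bound_bigo[where
          C = "(a 0 powr p / (2 powr (p - 1) * \<beta>' * \<kappa>)) powr (1 / (p - 1))"])
      (auto simp: powr_minus_divide)
  moreover have "(\<lambda>\<epsilon>. real (the_enat (N \<epsilon>))) \<in> O[at_right 0](\<lambda>\<epsilon>. \<epsilon> powr (- 1))" if "p = 2"
    using quadratic[OF that] kappa beta
    by (intro enat_ceiling_bound_bigo[where C = "(a 0)\<^sup>2 / (2 * \<kappa> * \<beta>')"])
      (auto simp: powr_minus_divide)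
  moreover have "(\<lambda>\<epsilon>. real (the_enat (N \<epsilon>))) \<in> O[at_right 0](\<lambda>\<epsilon>. \<epsilon> powr (- (2 / p)))" if "2 < p"
    using large[OF that] p
    by (intro enat_ceiling_bound_bigo[where
          C = "(1 / (\<beta>' * \<kappa> * p)) powr (2 / p) * ((p - 2) / p) powr ((p - 2) / p) * (a 0)\<^sup>2"])
      (auto simp: powr_minus_divide)
  ultimately show ?thesis
    using small quadratic large unfolding a_def by blast
qed

end
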